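(* Let $X$ and $Y$ be $\mathbb{R}$-linear spaces and let $g:X\to Y$ be a mapping such that there are $a^*,a^*_0,a^*_1\in X$ for which $g(a^*_0)-g(a^* )$ and $g(a^*_1)-g(a^* )$ are linearly independent. Then $g$ is an affine mapping if and only if $g$ satisfies both of the following conditions: (i) for every line $L\subseteq X$, the image $g[L]$ is either a point or a line in $Y$; and (ii) for every line $L\subseteq X$, if $g[L]$ is a line in $Y$, then the restriction $g\restriction L$ is injective.
   Context: An $\mathbb{R}$-linear space is a vector space over $\mathbb{R}$ (of arbitrary, possibly infinite, dimension). A mapping $g:X\to Y$ is affine if there are an $\mathbb{R}$-linear mapping $f:X\to Y$ and $b\in Y$ such that $g(a)=f(a)+b$ for all $a\in X$. A subset of a linear space is a point if it is a singleton. A line is an affine subspace of dimension $1$, i.e. a set of the form $\{rd+a : r\in\mathbb{R}\}$ with $d\neq 0$. For $U\subseteq X$, $g[U]=\{g(u):u\in U\}$. *)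

theory Defs
  imports Complex_Main
begin

definition affine_mapping :: "('a::real_vector \<Rightarrow> 'b::real_vector) \<Rightarrow> bool" where
  "affine_mapping g \<longleftrightarrow> (\<exists>f b. linear f \<and> (\<forall>a. g a = f a + b))"

definition is_line :: "'a::real_vector set \<Rightarrow> bool" where
  "is_line L \<longleftrightarrow> (\<exists>d a. d \<noteq> 0 \<and> L = {r *\<^sub>R d + a | r. True})"

(* Linear independence of the two-element family (u, v): since independent speaks
   about sets, and {u, u} = {u}, the vectors must also be required to be distinct. *)
definition lin_indep_pair :: "'a::real_vector \<Rightarrow> 'a \<Rightarrow> bool" where
  "lin_indep_pair u v \<longleftrightarrow> u \<noteq> v \<and> independent {u, v}"

end

theory Submission
  imports Defs
begin

text \<open>
  This is a fundamental theorem of affine geometry for mappings that need not be injective.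
  The two conditions together say that along every line \<open>g\<close> is either constant or a bijection
  onto a line. After a translation in source and target we may assume \<open>g 0 = 0\<close>; linearity of
  the resulting mapping \<open>h\<close> has to be shown.

  The first point is that \<open>h\<close> factors through its zero set: if \<open>h v = 0\<close>, then \<open>v\<close> is a period
  of \<open>h\<close>. Otherwise \<open>h\<close> would be injective on some line \<open>y + \<real>v\<close> containing no zero of \<open>h\<close>, as the
  zeros form a subspace. The midpoint \<open>y/2\<close> lies on two segments, from \<open>0\<close> to \<open>y\<close> and from \<open>-v\<close> to \<open>y + v\<close>, whose images lie on two distinct lines through \<open>0\<close>;
  then \<open>h\<close> vanishes at \<open>y/2\<close>, hence at \<open>y\<close>, a contradiction (lemma \<open>period\<close>).
  Periodicity gives the parallelogram law when \<open>h d\<close> and \<open>h e\<close> are independent: the lines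
  \<open>\<real>d\<close> and \<open>e + \<real>d\<close> have disjoint coplanar, hence parallel, images. A vector whose
  image is independent of \<open>h d\<close>, supplied by the hypothesis on the rank, extends additivity to
  all pairs (lemma \<open>add\<close>).

  Finally \<open>h (r d)\<close> is a multiple of \<open>h d\<close>, and comparing coefficients in
  \<open>h (r (d + e)) = h (r d) + h (r e)\<close> shows that the factor depends only on \<open>r\<close>. As a function of \<open>r\<close>
  it is a ring endomorphism of \<open>\<real>\<close>, and the identity is the only one.
\<close>

section \<open>Independent pairs and endomorphisms of the reals\<close>

lemma lin_indep_pair_iff:
  "lin_indep_pair u v \<longleftrightarrow> (\<forall>a b. a *\<^sub>R u + b *\<^sub>R v = 0 \<longrightarrow> a = 0 \<and> b = 0)"
proof
  assume ind: "lin_indep_pair u v"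
  then have ne: "u \<noteq> v" and iv: "independent {v, u}"
    by (auto simp: lin_indep_pair_def insert_commute)
  have u0: "u \<noteq> 0"
    using iv dependent_zero by blast
  have v: "v \<notin> span {u}"
    using iv ne by (auto simp: independent_insert)
  show "\<forall>a b. a *\<^sub>R u + b *\<^sub>R v = 0 \<longrightarrow> a = 0 \<and> b = 0"
  proof (intro allI impI)
    fix a b :: real
    assume eq: "a *\<^sub>R u + b *\<^sub>R v = 0"
    have "b = 0"
    proof (rule ccontr)
      assume b: "b \<noteq> 0"
      have "b *\<^sub>R v = (- a) *\<^sub>R u"
        using eq by (simp add: eq_neg_iff_add_eq_0 add.commute)
      then have "inverse b *\<^sub>R (b *\<^sub>R v) = inverse b *\<^sub>R ((- a) *\<^sub>R u)"
        by simp
      then have "v = (inverse b * (- a)) *\<^sub>R u"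
        using b by simp
      then show False
        using v by (metis span_base span_scale singletonI)
    qed
    then show "a = 0 \<and> b = 0"
      using eq u0 by simp
  qed
next
  assume coeffs: "\<forall>a b. a *\<^sub>R u + b *\<^sub>R v = 0 \<longrightarrow> a = 0 \<and> b = 0"
  have ne: "u \<noteq> v"
    using coeffs[rule_format, of 1 "-1"] by auto
  have u0: "u \<noteq> 0"
    using coeffs[rule_format, of 1 0] by auto
  have "v \<notin> span {u}"
  proof
    assume "v \<in> span {u}"
    then obtain k where "v = k *\<^sub>R u"
      by (auto simp: span_singleton)
    then show False
      using coeffs[rule_format, of k "-1"] by auto
  qed
  then have "independent {v, u}"
    using u0 ne by (auto simp: independent_insert)
  then show "lin_indep_pair u v"
    using ne by (simp add: lin_indep_pair_def insert_commute)
qed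

lemma lin_indep_pair_coeffs_eq:
  assumes "lin_indep_pair u v" "a *\<^sub>R u + b *\<^sub>R v = a' *\<^sub>R u + b' *\<^sub>R v"
  shows "a = a'" "b = b'"
proof -
  have "(a - a') *\<^sub>R u + (b - b') *\<^sub>R v = 0"
    using assms(2) by (simp add: algebra_simps)
  then have "a - a' = 0 \<and> b - b' = 0"
    using assms(1) unfolding lin_indep_pair_iff by blast
  then show "a = a'" "b = b'"
    by auto
qed

lemma lin_indep_pair_commute: "lin_indep_pair u v \<longleftrightarrow> lin_indep_pair v u"
  by (auto simp: lin_indep_pair_def insert_commute)

lemma lin_indep_pair_nonzero:
  assumes "lin_indep_pair u v"
  shows "u \<noteq> 0" "v \<noteq> 0"
  using assms dependent_zero by (auto simp: lin_indep_pair_def)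

lemma not_lin_indep_pair_imp_multiple:
  assumes "\<not> lin_indep_pair u v" "u \<noteq> 0"
  obtains c where "v = c *\<^sub>R u"
proof -
  from assms(1) obtain a b where ab: "a *\<^sub>R u + b *\<^sub>R v = 0" "a \<noteq> 0 \<or> b \<noteq> 0"
    unfolding lin_indep_pair_iff by blast
  have b: "b \<noteq> 0"
    using ab assms(2) by auto
  have "b *\<^sub>R v = (- a) *\<^sub>R u"
    using ab by (simp add: eq_neg_iff_add_eq_0 add.commute)
  then have "inverse b *\<^sub>R (b *\<^sub>R v) = inverse b *\<^sub>R ((- a) *\<^sub>R u)"
    by simp
  then have "v = (inverse b * (- a)) *\<^sub>R u"
    using b by simp
  then show thesis
    by (rule that)
qed

lemma multiples_not_lin_indep_pair: "\<not> lin_indep_pair (a *\<^sub>R u) (b *\<^sub>R u)"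
proof
  assume ind: "lin_indep_pair (a *\<^sub>R u) (b *\<^sub>R u)"
  have "b *\<^sub>R (a *\<^sub>R u) + (- a) *\<^sub>R (b *\<^sub>R u) = 0"
    by simp
  then have "b = 0"
    using ind unfolding lin_indep_pair_iff by blast
  then show False
    using lin_indep_pair_nonzero(2)[OF ind] by simp
qed

lemma lin_indep_pair_with_one:
  assumes "lin_indep_pair u v" "w \<noteq> 0"
  shows "lin_indep_pair w u \<or> lin_indep_pair w v"
  using assms not_lin_indep_pair_imp_multiple[OF _ assms(2)] multiples_not_lin_indep_pair by metis

text \<open>
  Squares go to squares, so the endomorphism is monotone, and a monotone additive function that
  fixes \<open>1\<close> cannot move a point past a multiple of \<open>1/n\<close>, for any \<open>n\<close>.
\<close>

lemma real_ring_endomorphism_is_identity: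
  fixes \<phi> :: "real \<Rightarrow> real"
  assumes add: "\<And>x y. \<phi> (x + y) = \<phi> x + \<phi> y"
    and mult: "\<And>x y. \<phi> (x * y) = \<phi> x * \<phi> y"
    and one: "\<phi> 1 = 1"
  shows "\<phi> x = x"
proof -
  have zero: "\<phi> 0 = 0"
    using add[of 0 0] by simp
  have minus: "\<phi> (- x) = - \<phi> x" for x
    using add[of x "- x"] zero by simp
  have of_nat: "\<phi> (real n) = real n" for n
    by (induction n) (simp_all add: zero one add)
  have of_int: "\<phi> (of_int k) = of_int k" for k
    by (cases k) (simp_all add: of_nat minus one add del: of_nat_Suc)
  have nonneg: "0 \<le> \<phi> x" if "0 \<le> x" for x
  proof -
    have "\<phi> x = \<phi> (sqrt x) * \<phi> (sqrt x)"
      using that by (simp flip: mult)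
    then show ?thesis
      by simp
  qed
  have mono: "\<phi> x \<le> \<phi> y" if "x \<le> y" for x y
    using nonneg[of "y - x"] add[of x "y - x"] that by simp
  have close: "real n * \<bar>\<phi> x - x\<bar> \<le> 1" for n
  proof -
    define k where "k = \<lfloor>real n * x\<rfloor>"
    have k: "of_int k \<le> real n * x" "real n * x \<le> of_int (k + 1)"
      unfolding k_def by linarith+
    have "of_int k \<le> real n * \<phi> x" "real n * \<phi> x \<le> of_int (k + 1)"
      using mono[OF k(1)] mono[OF k(2)] unfolding mult of_nat of_int by simp_all
    then have "\<bar>real n * \<phi> x - real n * x\<bar> \<le> 1"
      using k by simp
    then show ?thesis
      by (simp add: abs_mult flip: right_diff_distrib)
  qed
  show ?thesis
  proof (rule ccontr)
    assume "\<phi> x \<noteq> x"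
    then have "0 < \<bar>\<phi> x - x\<bar>"
      by simp
    then obtain n where "1 < real n * \<bar>\<phi> x - x\<bar>"
      using reals_Archimedean3 by blast
    then show False
      using close[of n] by simp
  qed
qed

section \<open>Mappings that are constant or onto along lines\<close>

text \<open>
  Conditions (i) and (ii), relative to parametrised lines: the line through \<open>x\<close> and \<open>y\<close> is
  mapped onto the line through \<open>h x\<close> and \<open>h y\<close>, which may degenerate to a point, and two coinciding
  values force the degenerate case.
\<close>

locale lineation =
  fixes h :: "'a::real_vector \<Rightarrow> 'b::real_vector"
  assumes const: "h x = h y \<Longrightarrow> h (x + r *\<^sub>R (y - x)) = h x"
    and into: "\<exists>s. h (x + r *\<^sub>R (y - x)) = h x + s *\<^sub>R (h y - h x)"
    and onto: "\<exists>r. h (x + r *\<^sub>R (y - x)) = h x + s *\<^sub>R (h y - h x)"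

lemma lineation_of_line_conditions:
  fixes g :: "'a::real_vector \<Rightarrow> 'b::real_vector"
  assumes img: "\<And>L. is_line L \<Longrightarrow> is_singleton (g ` L) \<or> is_line (g ` L)"
    and inj: "\<And>L. is_line L \<Longrightarrow> is_line (g ` L) \<Longrightarrow> inj_on g L"
  shows "lineation g"
proof -
  have main: "(g x = g y \<longrightarrow> (\<forall>r. g (x + r *\<^sub>R (y - x)) = g x)) \<and>
      (\<forall>r. \<exists>s. g (x + r *\<^sub>R (y - x)) = g x + s *\<^sub>R (g y - g x)) \<and>
      (\<forall>s. \<exists>r. g (x + r *\<^sub>R (y - x)) = g x + s *\<^sub>R (g y - g x))" for x y
  proof (cases "x = y")
    case True
    then show ?thesis by simp
  next
    case False
    define L where "L = {r *\<^sub>R (y - x) + x | r. True}"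
    have L: "is_line L"
      unfolding is_line_def L_def using False by (intro exI[of _ "y - x"] exI[of _ x]) auto
    have pt: "x + r *\<^sub>R (y - x) \<in> L" for r
      unfolding L_def by (auto simp: add.commute)
    have xL: "x \<in> L" and yL: "y \<in> L"
      using pt[of 0] pt[of 1] by auto
    consider (point) "is_singleton (g ` L)" | (line) "is_line (g ` L)"
      using img[OF L] by blast
    then show ?thesis
    proof cases
      case point
      then obtain c where "g ` L = {c}"
        by (auto simp: is_singleton_def)
      then have "g z = c" if "z \<in> L" for z
        using that by blast
      then show ?thesis
        using pt xL yL by simp
    next
      case line
      have ne: "g x \<noteq> g y"
        using inj[OF L line] xL yL False by (auto dest: inj_onD)
      obtain d a where img_eq: "g ` L = {r *\<^sub>R d + a | r. True}"
        using line unfolding is_line_def by blast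
      obtain p where p: "g x = p *\<^sub>R d + a"
        using img_eq xL by blast
      obtain q where q: "g y = q *\<^sub>R d + a"
        using img_eq yL by blast
      have pq: "q - p \<noteq> 0"
        using ne p q by auto
      have diff: "g y - g x = (q - p) *\<^sub>R d"
        using p q by (simp add: algebra_simps)
      have "\<exists>s. g (x + r *\<^sub>R (y - x)) = g x + s *\<^sub>R (g y - g x)" for r
      proof -
        obtain t where t: "g (x + r *\<^sub>R (y - x)) = t *\<^sub>R d + a"
          using img_eq pt by blast
        have "((t - p) / (q - p)) *\<^sub>R (g y - g x) = (t - p) *\<^sub>R d"
          unfolding diff using pq by simp
        then have "g (x + r *\<^sub>R (y - x)) = g x + ((t - p) / (q - p)) *\<^sub>R (g y - g x)"
          unfolding t p by (simp add: scaleR_left_diff_distrib)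
        then show ?thesis ..
      qed
      moreover have "\<exists>r. g (x + r *\<^sub>R (y - x)) = g x + s *\<^sub>R (g y - g x)" for s
      proof -
        have "g x + s *\<^sub>R (g y - g x) = (p + s * (q - p)) *\<^sub>R d + a"
          unfolding diff unfolding p by (simp add: algebra_simps)
        then have "g x + s *\<^sub>R (g y - g x) \<in> g ` L"
          unfolding img_eq by blast
        then show ?thesis
          unfolding L_def by (auto simp: add.commute)
      qed
      ultimately show ?thesis
        using ne by blast
    qed
  qed
  show ?thesis
    by unfold_locales (use main in blast)+
qed

lemma (in lineation) lineation_translate: "lineation (\<lambda>x. h (x + a) - h a)"
proof
  fix x y r s
  have shift: "x + r *\<^sub>R (y - x) + a = (x + a) + r *\<^sub>R ((y + a) - (x + a))" for r
    by simp
  have diff: "h (x + a) - h a + s *\<^sub>R (h (y + a) - h a - (h (x + a) - h a)) =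
      h (x + a) + s *\<^sub>R (h (y + a) - h (x + a)) - h a" for s
    by simp
  show "h (x + r *\<^sub>R (y - x) + a) - h a = h (x + a) - h a"
    if "h (x + a) - h a = h (y + a) - h a"
    using that const[of "x + a" "y + a" r] unfolding shift by simp
  show "\<exists>s. h (x + r *\<^sub>R (y - x) + a) - h a =
      h (x + a) - h a + s *\<^sub>R (h (y + a) - h a - (h (x + a) - h a))"
    unfolding shift diff using into[of "x + a" r "y + a"] by auto
  show "\<exists>r. h (x + r *\<^sub>R (y - x) + a) - h a =
      h (x + a) - h a + s *\<^sub>R (h (y + a) - h a - (h (x + a) - h a))"
    unfolding shift diff using onto[of "x + a" "y + a" s] by auto
qed

section \<open>The zero set consists of periods\<close>

locale pointed_lineation = lineation +
  assumes zero [simp]: "h 0 = 0"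
begin

lemma scale_into: "\<exists>s. h (r *\<^sub>R d) = s *\<^sub>R h d"
  using into[of 0 r d] by simp

lemma scale_onto: "\<exists>r. h (r *\<^sub>R d) = s *\<^sub>R h d"
  using onto[of 0 d s] by simp

lemma null_scale: "h v = 0 \<Longrightarrow> h (r *\<^sub>R v) = 0"
  using const[of 0 v r] by simp

text \<open>The sum is twice the midpoint, and the midpoint is on a line through two zeros.\<close>

lemma null_add:
  assumes "h u = 0" "h v = 0"
  shows "h (u + v) = 0"
proof -
  have "h (u + (1/2) *\<^sub>R (v - u)) = 0"
    using const[of u v] assms by simp
  then have "h (2 *\<^sub>R (u + (1/2) *\<^sub>R (v - u))) = 0"
    by (rule null_scale)
  then show ?thesis
    by (simp add: algebra_simps scaleR_2)
qed

lemma period: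
  assumes v: "h v = 0"
  shows "h (y + v) = h y"
proof (cases "h y = 0")
  case True
  then show ?thesis
    using null_add v by simp
next
  case False
  show ?thesis
  proof (rule ccontr)
    assume ne: "h (y + v) \<noteq> h y"
    \<comment> \<open>A zero of \<open>h\<close> on \<open>y + \<real>v\<close> would make \<open>y\<close> a zero as well, since zeros form a subspace.\<close>
    have off: "h y + s *\<^sub>R (h (y + v) - h y) \<noteq> 0" for s
    proof
      assume "h y + s *\<^sub>R (h (y + v) - h y) = 0"
      then obtain r where "h (y + r *\<^sub>R v) = 0"
        using onto[of y "y + v" s] by auto
      then have "h ((y + r *\<^sub>R v) + (- r) *\<^sub>R v) = 0"
        using null_add null_scale v by blast
      then show False
        using False by simp
    qed
    have ind: "lin_indep_pair (h y) (h (y + v))"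
    proof (rule ccontr)
      assume "\<not> lin_indep_pair (h y) (h (y + v))"
      then obtain c where c: "h (y + v) = c *\<^sub>R h y"
        using False not_lin_indep_pair_imp_multiple by blast
      have "c \<noteq> 1"
        using c ne by auto
      then have "1 + (1 / (1 - c)) * (c - 1) = 0"
        by (simp add: field_simps)
      moreover have "h y + (1 / (1 - c)) *\<^sub>R (h (y + v) - h y) = (1 + (1 / (1 - c)) * (c - 1)) *\<^sub>R h y"
        unfolding c scaleR_left_distrib scaleR_left_diff_distrib
        by (simp add: algebra_simps diff_divide_distrib)
      ultimately show False
        using off[of "1 / (1 - c)"] by simp
    qed
    have "h (- v) = 0"
      using null_scale[OF v, of "-1"] by simp
    moreover have mid: "- v + (1/2) *\<^sub>R ((y + v) - (- v)) = (1/2) *\<^sub>R y"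
      by (simp add: algebra_simps flip: scaleR_add_left)
    ultimately obtain s where s: "h ((1/2) *\<^sub>R y) = s *\<^sub>R h (y + v)"
      using into[of "- v" "1/2" "y + v"] by auto
    obtain t where t: "h ((1/2) *\<^sub>R y) = t *\<^sub>R h y"
      using scale_into by blast
    have "t = 0"
      using lin_indep_pair_coeffs_eq(1)[OF ind, of t 0 0 s] s t by simp
    then have "h ((1/2) *\<^sub>R y) = 0"
      using t by simp
    then have "h (2 *\<^sub>R (1/2) *\<^sub>R y) = 0"
      by (rule null_scale)
    then show False
      using False by simp
  qed
qed

text \<open>
  The converse of periodicity, based at an arbitrary point: moving the origin to \<open>x\<close> turns
  \<open>v\<close> into a zero, hence into a period.
\<close>

lemma null_of_eq:
  assumes "h (x + v) = h x"
  shows "h v = 0"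
proof -
  interpret k: pointed_lineation "\<lambda>z. h (z + x) - h x"
    using lineation_translate[of x]
    by (simp add: pointed_lineation_def pointed_lineation_axioms_def)
  have "h (v + x) - h x = 0"
    using assms by (simp add: add.commute)
  from k.period[OF this, of "- x"] show ?thesis
    by simp
qed

section \<open>Additivity\<close>

lemma plane_into: "\<exists>a b. h (d + e) = a *\<^sub>R h d + b *\<^sub>R h e"
proof -
  obtain t where t: "h (d + (1/2) *\<^sub>R (e - d)) = h d + t *\<^sub>R (h e - h d)"
    using into by blast
  have twice: "d + e = 2 *\<^sub>R (d + (1/2) *\<^sub>R (e - d))"
    by (simp add: algebra_simps scaleR_2)
  obtain u where "h (d + e) = u *\<^sub>R (h d + t *\<^sub>R (h e - h d))"
    using scale_into[of 2 "d + (1/2) *\<^sub>R (e - d)"] unfolding twice t by blast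
  then have "h (d + e) = (u * (1 - t)) *\<^sub>R h d + (u * t) *\<^sub>R h e"
    by (simp add: algebra_simps)
  then show ?thesis by blast
qed

text \<open>
  If the coefficient of \<open>h e\<close> differed from \<open>1\<close>, the image of \<open>e + \<real>d\<close> would meet the image of \<open>\<real>d\<close>;
  by periodicity \<open>e\<close> would then be a multiple of \<open>d\<close> up to a period.
\<close>

lemma parallel_coeff:
  assumes ind: "lin_indep_pair (h d) (h e)"
    and eq: "h (d + e) = a *\<^sub>R h d + b *\<^sub>R h e"
  shows "b = 1"
proof (rule ccontr)
  assume b: "b \<noteq> 1"
  \<comment> \<open>The parameter \<open>1 / (1 - b)\<close> cancels the coefficient of \<open>h e\<close>.\<close>
  obtain s where "h (e + s *\<^sub>R d) = h e + (1 / (1 - b)) *\<^sub>R (h (d + e) - h e)"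
    using onto[of e "d + e"] by auto
  moreover have "h e + (1 / (1 - b)) *\<^sub>R (h (d + e) - h e) = (a / (1 - b)) *\<^sub>R h d + (1 + (b - 1) / (1 - b)) *\<^sub>R h e"
    unfolding eq by (simp add: algebra_simps diff_divide_distrib)
  moreover have "1 + (b - 1) / (1 - b) = 0"
    using b by (simp add: field_simps)
  ultimately have meet: "h (e + s *\<^sub>R d) = (a / (1 - b)) *\<^sub>R h d"
    by simp
  obtain s' where s': "h (s' *\<^sub>R d) = (a / (1 - b)) *\<^sub>R h d"
    using scale_onto by blast
  have "h (s' *\<^sub>R d + (e + (s - s') *\<^sub>R d)) = h (s' *\<^sub>R d)"
    using meet s' by (simp add: algebra_simps)
  then have "h (e + (s - s') *\<^sub>R d) = 0"
    by (rule null_of_eq)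
  then have "h ((s' - s) *\<^sub>R d + (e + (s - s') *\<^sub>R d)) = h ((s' - s) *\<^sub>R d)"
    by (rule period)
  then have "h e = h ((s' - s) *\<^sub>R d)"
    by (simp add: algebra_simps)
  then obtain c where "h e = c *\<^sub>R h d"
    using scale_into by metis
  then show False
    using ind multiples_not_lin_indep_pair[of 1 "h d" c] by simp
qed

lemma add_of_indep:
  assumes ind: "lin_indep_pair (h d) (h e)"
  shows "h (d + e) = h d + h e"
proof -
  obtain a b where eq: "h (d + e) = a *\<^sub>R h d + b *\<^sub>R h e"
    using plane_into by blast
  have "b = 1"
    using parallel_coeff[OF ind eq] .
  moreover have "a = 1"
    by (rule parallel_coeff[of e d b a]) (use ind eq in \<open>simp_all add: lin_indep_pair_commute add.commute\<close>)
  ultimately show ?thesis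
    using eq by simp
qed

end

locale planar_lineation = pointed_lineation +
  assumes rank: "\<exists>p q. lin_indep_pair (h p) (h q)"
begin

text \<open>
  When \<open>h e = c h d\<close>, pick \<open>w\<close> with \<open>h w\<close> independent of \<open>h d\<close> and expand \<open>h (d + e + w)\<close> in
  two ways, each using only sums of vectors with independent images or periods.
\<close>

lemma add: "h (d + e) = h d + h e"
proof (cases "h d = 0 \<or> lin_indep_pair (h d) (h e)")
  case True
  then show ?thesis
    using period[of d e] add_of_indep by (auto simp: add.commute)
next
  case False
  then have d: "h d \<noteq> 0" and dep: "\<not> lin_indep_pair (h d) (h e)"
    by auto
  obtain c where c: "h e = c *\<^sub>R h d"
    using not_lin_indep_pair_imp_multiple[OF dep d] .
  obtain w where w: "lin_indep_pair (h d) (h w)"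
    using rank lin_indep_pair_with_one[OF _ d] by blast
  have multiple_add: "h (z + w) = h z + h w" if z: "h z = k *\<^sub>R h d" for z k
  proof (cases "h z = 0")
    case True
    then show ?thesis
      using period[of z w] by (simp add: add.commute)
  next
    case False
    have "lin_indep_pair (h z) (h w)"
      unfolding lin_indep_pair_iff
    proof (intro allI impI)
      fix a b :: real
      assume "a *\<^sub>R h z + b *\<^sub>R h w = 0"
      then have "(a * k) *\<^sub>R h d + b *\<^sub>R h w = 0"
        using z by simp
      then have "a * k = 0 \<and> b = 0"
        using w unfolding lin_indep_pair_iff by blast
      then show "a = 0 \<and> b = 0"
        using z False by auto
    qed
    then show ?thesis
      by (rule add_of_indep)
  qed
  have ew: "h (e + w) = h e + h w"
    using multiple_add[OF c] .
  have "lin_indep_pair (h d) (h (e + w))"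
    unfolding lin_indep_pair_iff ew c
  proof (intro allI impI)
    fix a b :: real
    assume "a *\<^sub>R h d + b *\<^sub>R (c *\<^sub>R h d + h w) = 0"
    then have "(a + b * c) *\<^sub>R h d + b *\<^sub>R h w = 0"
      by (simp add: algebra_simps)
    then have "a + b * c = 0 \<and> b = 0"
      using w unfolding lin_indep_pair_iff by blast
    then show "a = 0 \<and> b = 0"
      by auto
  qed
  then have left: "h (d + (e + w)) = h d + h e + h w"
    using add_of_indep ew by (simp add: add.assoc)
  obtain k where "h (d + e) = k *\<^sub>R h d"
  proof -
    obtain a b where "h (d + e) = a *\<^sub>R h d + b *\<^sub>R h e"
      using plane_into by blast
    then have "h (d + e) = (a + b * c) *\<^sub>R h d"
      using c by (simp add: algebra_simps)
    then show thesis
      by (rule that)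
  qed
  then have "h ((d + e) + w) = h (d + e) + h w"
    by (rule multiple_add)
  then show ?thesis
    using left by (simp add: add.assoc)
qed

section \<open>Homogeneity\<close>

lemma factor_eq_of_indep:
  assumes ind: "lin_indep_pair (h d) (h e)"
    and s: "h (r *\<^sub>R d) = s *\<^sub>R h d" and t: "h (r *\<^sub>R e) = t *\<^sub>R h e"
  shows "s = t"
proof -
  obtain u where "h (r *\<^sub>R (d + e)) = u *\<^sub>R h (d + e)"
    using scale_into by blast
  then have "s *\<^sub>R h d + t *\<^sub>R h e = u *\<^sub>R h d + u *\<^sub>R h e"
    using s t by (simp add: scaleR_right_distrib add)
  then show ?thesis
    using lin_indep_pair_coeffs_eq[OF ind] by metis
qed

text \<open>Fix \<open>p\<close> and \<open>q\<close> with independent images; any \<open>h d \<noteq> 0\<close> is independent of one of them.\<close>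

lemma uniform_factor: "\<exists>s. \<forall>d. h (r *\<^sub>R d) = s *\<^sub>R h d"
proof -
  obtain p q where pq: "lin_indep_pair (h p) (h q)"
    using rank by blast
  obtain s where s: "h (r *\<^sub>R p) = s *\<^sub>R h p"
    using scale_into by blast
  obtain s' where "h (r *\<^sub>R q) = s' *\<^sub>R h q"
    using scale_into by blast
  then have s': "h (r *\<^sub>R q) = s *\<^sub>R h q"
    using factor_eq_of_indep[OF pq s] by metis
  have "h (r *\<^sub>R d) = s *\<^sub>R h d" for d
  proof (cases "h d = 0")
    case True
    then show ?thesis
      using null_scale by simp
  next
    case False
    obtain t where t: "h (r *\<^sub>R d) = t *\<^sub>R h d"
      using scale_into by blast
    have "lin_indep_pair (h d) (h p) \<or> lin_indep_pair (h d) (h q)"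
      using lin_indep_pair_with_one[OF pq False] .
    then have "t = s"
      using factor_eq_of_indep[OF _ t s] factor_eq_of_indep[OF _ t s'] by blast
    then show ?thesis
      using t by simp
  qed
  then show ?thesis by blast
qed

lemma linear: "linear h"
proof -
  obtain \<phi> where \<phi>: "\<And>r d. h (r *\<^sub>R d) = \<phi> r *\<^sub>R h d"
    using uniform_factor by metis
  obtain p where p: "h p \<noteq> 0"
    using rank lin_indep_pair_nonzero by blast
  have cancel: "s = t" if "s *\<^sub>R h p = t *\<^sub>R h p" for s t
    using that p by simp
  have "\<phi> r = r" for r
  proof (rule real_ring_endomorphism_is_identity)
    show "\<phi> (x + y) = \<phi> x + \<phi> y" for x y
      by (rule cancel) (simp add: scaleR_left_distrib add flip: \<phi>)
    show "\<phi> (x * y) = \<phi> x * \<phi> y" for x y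
      by (rule cancel) (simp flip: \<phi> scaleR_scaleR)
    show "\<phi> 1 = 1"
      by (rule cancel) (simp flip: \<phi>)
  qed
  then show ?thesis
    using \<phi> by (intro linearI add) simp
qed

end

section \<open>The characterisation of affine mappings\<close>

lemma affine_mapping_line_conditions:
  assumes g: "affine_mapping g" and L: "is_line L"
  shows "is_singleton (g ` L) \<or> is_line (g ` L)"
    and "is_line (g ` L) \<Longrightarrow> inj_on g L"
proof -
  obtain f b where f: "linear f" and gf: "\<And>x. g x = f x + b"
    using g unfolding affine_mapping_def by blast
  obtain d a where L_eq: "L = {r *\<^sub>R d + a | r. True}"
    using L unfolding is_line_def by blast
  have g_pt: "g (r *\<^sub>R d + a) = r *\<^sub>R f d + (f a + b)" for r
    using f by (simp add: gf linear_add linear_scale)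
  have img: "g ` L = {r *\<^sub>R f d + (f a + b) | r. True}"
    unfolding L_eq by (auto simp: g_pt image_iff) (metis g_pt)
  show "is_singleton (g ` L) \<or> is_line (g ` L)"
  proof (cases "f d = 0")
    case True
    then show ?thesis
      using img by (simp add: is_singleton_def)
  next
    case False
    then show ?thesis
      unfolding is_line_def using img by blast
  qed
  show "inj_on g L" if line: "is_line (g ` L)"
  proof -
    have "f d \<noteq> 0"
    proof
      assume "f d = 0"
      then have img1: "g ` L = {f a + b}"
        using img by simp
      obtain d' a' where d': "d' \<noteq> 0" and "g ` L = {r *\<^sub>R d' + a' | r. True}"
        using line unfolding is_line_def by blast
      then have on_img: "r *\<^sub>R d' + a' = f a + b" for r
        using img1 by blast
      show False
        using on_img[of 0] on_img[of 1] d' by simp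
    qed
    then show ?thesis
      unfolding L_eq by (auto simp: inj_on_def g_pt)
  qed
qed

theorem corollary4p2:
  fixes g :: "'a::real_vector \<Rightarrow> 'b::real_vector"
  assumes "\<exists>a a0 a1. lin_indep_pair (g a0 - g a) (g a1 - g a)"
  shows "affine_mapping g \<longleftrightarrow>
    (\<forall>L. is_line L \<longrightarrow> is_singleton (g ` L) \<or> is_line (g ` L)) \<and>
    (\<forall>L. is_line L \<longrightarrow> is_line (g ` L) \<longrightarrow> inj_on g L)"
proof
  assume "affine_mapping g"
  then show "(\<forall>L. is_line L \<longrightarrow> is_singleton (g ` L) \<or> is_line (g ` L)) \<and>
    (\<forall>L. is_line L \<longrightarrow> is_line (g ` L) \<longrightarrow> inj_on g L)"
    using affine_mapping_line_conditions by blast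
next
  assume lines: "(\<forall>L. is_line L \<longrightarrow> is_singleton (g ` L) \<or> is_line (g ` L)) \<and>
    (\<forall>L. is_line L \<longrightarrow> is_line (g ` L) \<longrightarrow> inj_on g L)"
  obtain a a0 a1 where ind: "lin_indep_pair (g a0 - g a) (g a1 - g a)"
    using assms by blast
  define h where "h = (\<lambda>x. g (x + a) - g a)"
  interpret g: lineation g
    using lines by (intro lineation_of_line_conditions) blast+
  interpret h: planar_lineation h
  proof (intro planar_lineation.intro pointed_lineation.intro
      pointed_lineation_axioms.intro planar_lineation_axioms.intro)
    show "lineation h"
      unfolding h_def by (rule g.lineation_translate)
    show "h 0 = 0"
      by (simp add: h_def)
    show "\<exists>p q. lin_indep_pair (h p) (h q)"
      using ind by (intro exI[of _ "a0 - a"] exI[of _ "a1 - a"]) (simp add: h_def)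
  qed
  have "g x = h x + (g a - h a)" for x
  proof -
    have "h ((x - a) + a) = h (x - a) + h a"
      by (rule h.add)
    moreover have "h (x - a) = g x - g a"
      by (simp add: h_def)
    ultimately show ?thesis
      by simp
  qed
  then show "affine_mapping g"
    unfolding affine_mapping_def using h.linear by blast
qed

end
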